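(* Let $\Phi(N)$ be the minimum number of nonempty cells in a partial Latin square with at least $N$ intercalates. Then, with $o(1)$ denoting quantities tending to $0$ as $N\to\infty$: (1) $\Phi(N)\ge(1+o(1))(4N)^{2/3}$ for all $N$; (2) $\Phi(N)=(1+o(1))(4N)^{2/3}$ when $(4N)^{1/3}$ is a power of two; (3) $\Phi(N)\le(4+o(1))(4N)^{2/3}$ for all $N$; (4) if $\varepsilon=\varepsilon(N)=o(1)$, then $\Phi(N+\varepsilon N)-\Phi(N)=o(N^{2/3})$.
   Context: A partial Latin square is an array (of any finite dimensions) in which some cells are filled with symbols, such that no symbol appears more than once in any row or column. An intercalate in a partial Latin square $L$ is a pair of rows $i<j$ and a pair of columns $x<y$ such that the four cells $(i,x),(i,y),(j,x),(j,y)$ are all filled and $L_{i,x}=L_{j,y}$, $L_{i,y}=L_{j,x}$. *)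

theory Defs
  imports Complex_Main "HOL-Library.Landau_Symbols"
begin

(* An m x n array with some cells filled is a partial map from cells (row, column) to symbols. *)
definition partial_latin_square :: "nat \<Rightarrow> nat \<Rightarrow> (nat \<times> nat \<rightharpoonup> 'a) \<Rightarrow> bool" where
  "partial_latin_square m n L \<longleftrightarrow>
     dom L \<subseteq> {..<m} \<times> {..<n} \<and>
     (\<forall>i x y s. L (i, x) = Some s \<and> L (i, y) = Some s \<longrightarrow> x = y) \<and>
     (\<forall>i j x s. L (i, x) = Some s \<and> L (j, x) = Some s \<longrightarrow> i = j)"

definition intercalates :: "(nat \<times> nat \<rightharpoonup> 'a) \<Rightarrow> (nat \<times> nat \<times> nat \<times> nat) set" where
  "intercalates L = {(i, j, x, y). i < j \<and> x < y \<and>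
     {(i, x), (i, y), (j, x), (j, y)} \<subseteq> dom L \<and>
     L (i, x) = L (j, y) \<and> L (i, y) = L (j, x)}"

(* A partial Latin square has only finitely many filled cells, so symbols may be taken in nat.
   The argument is real because Phi is also evaluated at N + eps * N, which need not be an
   integer. *)
definition Phi :: "real \<Rightarrow> nat" where
  "Phi N = (LEAST k. \<exists>m n (L :: nat \<times> nat \<rightharpoonup> nat).
     partial_latin_square m n L \<and> real (card (intercalates L)) \<ge> N \<and> card (dom L) = k)"

end

theory Submission
  imports Defs "HOL-Analysis.Convex" "HOL-Real_Asymp.Real_Asymp"
begin

text \<open>Lower bound: an intercalate together with a choice of one of its cells is determined by the
  row \<open>i\<close> and the column \<open>x\<close> of that cell and the symbol \<open>t\<close> that the cell does not
  carry. In a square with \<open>M\<close> filled cells, each of the pairs \<open>(i, x)\<close>, \<open>(x, t)\<close>, \<open>(i, t)\<close> takes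
  at most \<open>M\<close> values, so there are at most \<open>M powr (3/2)\<close> triples by the Loomis--Whitney
  inequality, which gives \<open>4 N \<le> M powr (3/2)\<close> with no error term.

  Upper bounds: the Cayley table of \<open>(\<int>/2)^k\<close> has \<open>n\<^sup>2\<close> cells and \<open>n\<^sup>2 (n - 1) / 4\<close> intercalates,
  where \<open>n = 2^k\<close>; and \<open>Phi\<close> is subadditive, as block diagonal sums show. So
  \<open>Phi x = O(x powr (2/3))\<close>, and subadditivity turns this crude bound into the control of the lower
  order corrections in (2) and (3) and of the perturbation in (4).\<close>

section \<open>Counting triples by their planar projections\<close>

text \<open>Slice \<open>T\<close> into fibres over \<open>A\<close>. By Cauchy-Schwarz it is enough
  to bound the sum of the squared fibre sizes, which counts pairs \<open>c\<close>,
  \<open>c'\<close> over a common \<open>(a, b)\<close>; such a pair can be recovered from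
  \<open>(b, c)\<close> in \<open>B\<close> and \<open>(a, c')\<close> in \<open>C\<close>.\<close>

lemma loomis_whitney_3:
  assumes "finite A" "finite B" "finite C"
    and T: "\<And>a b c. (a, b, c) \<in> T \<Longrightarrow> (a, b) \<in> A \<and> (b, c) \<in> B \<and> (a, c) \<in> C"
  shows "(card T)\<^sup>2 \<le> card A * card B * card C"
proof -
  define F where "F p = {c. (fst p, snd p, c) \<in> T}" for p
  have finF: "finite (F p)" for p
  proof (rule finite_subset)
    show "F p \<subseteq> snd ` B" using T unfolding F_def by force
  qed (use assms in auto)
  have "T = (\<lambda>((a, b), c). (a, b, c)) ` Sigma A F"
    using T unfolding F_def by (force simp: image_iff)
  moreover have "inj_on (\<lambda>((a, b), c). (a, b, c)) (Sigma A F)"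
    by (auto simp: inj_on_def)
  ultimately have "card T = card (Sigma A F)"
    by (metis card_image)
  then have cT: "card T = (\<Sum>p\<in>A. card (F p))"
    using assms finF by simp
  have "card (SIGMA p:A. F p \<times> F p) \<le> card (B \<times> C)"
  proof (rule card_inj_on_le)
    show "inj_on (\<lambda>((a, b), c, c'). ((b, c), (a, c'))) (SIGMA p:A. F p \<times> F p)"
      by (auto simp: inj_on_def)
    show "(\<lambda>((a, b), c, c'). ((b, c), (a, c'))) ` (SIGMA p:A. F p \<times> F p) \<subseteq> B \<times> C"
      using T by (auto simp: F_def)
  qed (use assms in auto)
  then have sq: "(\<Sum>p\<in>A. (card (F p))\<^sup>2) \<le> card B * card C"
    using assms finF by (simp add: card_cartesian_product power2_eq_square)
  have "(real (card T))\<^sup>2 = (\<Sum>p\<in>A. real (card (F p)))\<^sup>2"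
    by (simp add: cT)
  also have "\<dots> \<le> real (card A) * (\<Sum>p\<in>A. (real (card (F p)))\<^sup>2)"
    using sum_squared_le_sum_of_squares[of "\<lambda>p. real (card (F p))" A] by (simp add: mult.commute)
  also have "\<dots> = real (card A * (\<Sum>p\<in>A. (card (F p))\<^sup>2))"
    by simp
  also have "\<dots> \<le> real (card A * (card B * card C))"
    using sq by (intro of_nat_mono mult_left_mono) auto
  finally show ?thesis
    by (metis mult.assoc of_nat_le_iff of_nat_power)
qed

section \<open>Bounding the number of intercalates by the number of filled cells\<close>

text \<open>Leaving rows and columns unoriented lists each intercalate once for each of its four
  cells, with \<open>(i, x)\<close> as the marked cell.\<close>

definition ordered_intercalates :: "(nat \<times> nat \<rightharpoonup> 'a) \<Rightarrow> (nat \<times> nat \<times> nat \<times> nat) set" where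
  "ordered_intercalates L = {(i, j, x, y). i \<noteq> j \<and> x \<noteq> y \<and>
     {(i, x), (i, y), (j, x), (j, y)} \<subseteq> dom L \<and>
     L (i, x) = L (j, y) \<and> L (i, y) = L (j, x)}"

lemma finite_ordered_intercalates:
  assumes "finite (dom L)"
  shows "finite (ordered_intercalates L)"
proof (rule finite_subset)
  show "ordered_intercalates L \<subseteq> fst ` dom L \<times> fst ` dom L \<times> snd ` dom L \<times> snd ` dom L"
    by (force simp: ordered_intercalates_def)
qed (use assms in auto)

lemma finite_intercalates:
  assumes "finite (dom L)"
  shows "finite (intercalates L)"
  by (rule finite_subset[OF _ finite_ordered_intercalates[OF assms]])
     (auto simp: intercalates_def ordered_intercalates_def)

text \<open>The row swap \<open>r\<close> and the column swap \<open>c\<close> generate a group of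
  order four acting freely; the condition \<open>i < j\<close>, \<open>x < y\<close> selects one
  element of each orbit.\<close>

lemma card_ordered_intercalates:
  assumes "finite (dom L)"
  shows "card (ordered_intercalates L) = 4 * card (intercalates L)"
proof -
  let ?I = "intercalates L"
  define r where "r = (\<lambda>(i::nat, j::nat, x::nat, y::nat). (j, i, x, y))"
  define c where "c = (\<lambda>(i::nat, j::nat, x::nat, y::nat). (i, j, y, x))"
  note fin = finite_intercalates[OF assms]
  have inj: "inj r" "inj c"
    by (auto simp: inj_def r_def c_def)
  have 1: "ordered_intercalates L = (?I \<union> r ` ?I) \<union> c ` (?I \<union> r ` ?I)"
  proof (intro set_eqI iffI)
    fix z assume "z \<in> ordered_intercalates L"
    then obtain i j x y where z: "z = (i, j, x, y)" "i \<noteq> j" "x \<noteq> y"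
      and d: "{(i, x), (i, y), (j, x), (j, y)} \<subseteq> dom L" "L (i, x) = L (j, y)" "L (i, y) = L (j, x)"
      unfolding ordered_intercalates_def by blast
    consider "i < j" "x < y" | "j < i" "x < y" | "i < j" "y < x" | "j < i" "y < x"
      using z(2,3) by linarith
    then show "z \<in> (?I \<union> r ` ?I) \<union> c ` (?I \<union> r ` ?I)"
    proof cases
      case 1
      then show ?thesis using d by (simp add: z(1) intercalates_def)
    next
      case 2
      then have "(j, i, x, y) \<in> ?I" using d by (simp add: intercalates_def)
      then have "r (j, i, x, y) \<in> r ` ?I" by blast
      then show ?thesis by (simp add: z(1) r_def)
    next
      case 3
      then have "(i, j, y, x) \<in> ?I" using d by (simp add: intercalates_def)
      then have "c (i, j, y, x) \<in> c ` ?I" by blast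
      then show ?thesis by (simp add: z(1) c_def image_Un)
    next
      case 4
      then have "(j, i, y, x) \<in> ?I" using d by (simp add: intercalates_def)
      then have "c (r (j, i, y, x)) \<in> c ` r ` ?I" by blast
      then show ?thesis by (simp add: z(1) c_def r_def image_Un)
    qed
  qed (auto simp: ordered_intercalates_def intercalates_def r_def c_def)
  have I: "i < j \<and> x < y" if "(i, j, x, y) \<in> ?I" for i j x y
    using that unfolding intercalates_def by blast
  have Ir: "?I \<inter> r ` ?I = {}"
    by (auto simp: r_def dest!: I)
  \<comment> \<open>Row swaps keep the column order and \<open>c\<close> reverses it, which
    separates the two halves of the union.\<close>
  have J: "x < y" if "(i, j, x, y) \<in> ?I \<union> r ` ?I" for i j x y
    using that by (auto simp: r_def dest: I)
  have Jc: "(?I \<union> r ` ?I) \<inter> c ` (?I \<union> r ` ?I) = {}"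
  proof (rule equals0I, elim IntE imageE)
    fix z w assume "z \<in> ?I \<union> r ` ?I" "z = c w" "w \<in> ?I \<union> r ` ?I"
    moreover obtain i j x y where "w = (i, j, x, y)" by (metis surj_pair)
    ultimately have "(i, j, x, y) \<in> ?I \<union> r ` ?I" "(i, j, y, x) \<in> ?I \<union> r ` ?I"
      by (simp_all only: c_def prod.case)
    from this[THEN J] show False by simp
  qed
  have "card (ordered_intercalates L) = card (?I \<union> r ` ?I) + card (c ` (?I \<union> r ` ?I))"
    unfolding 1 using fin by (intro card_Un_disjoint Jc) simp_all
  also have "card (c ` (?I \<union> r ` ?I)) = card (?I \<union> r ` ?I)"
    by (rule card_image) (rule inj_on_subset[OF inj(2) subset_UNIV])
  also have "card (?I \<union> r ` ?I) = card ?I + card (r ` ?I)"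
    using fin by (intro card_Un_disjoint Ir) simp_all
  also have "card (r ` ?I) = card ?I"
    by (rule card_image) (rule inj_on_subset[OF inj(1) subset_UNIV])
  finally show ?thesis by simp
qed

text \<open>Loomis-Whitney is applied to the triples (row, column, symbol missing from the marked
  cell). Each projection is controlled by a filled cell: \<open>(i, x)\<close> itself,
  \<open>(j, x)\<close> for column and symbol, \<open>(i, y)\<close> for row and symbol.\<close>

lemma intercalates_bound:
  assumes "partial_latin_square m n L"
  shows "(4 * card (intercalates L))\<^sup>2 \<le> card (dom L) ^ 3"
proof -
  have row: "x = y" if "L (i, x) = Some s" "L (i, y) = Some s" for i x y s
    using assms that unfolding partial_latin_square_def by blast
  have col: "i = j" if "L (i, x) = Some s" "L (j, x) = Some s" for i j x s
    using assms that unfolding partial_latin_square_def by blast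
  have fin: "finite (dom L)"
    using assms by (auto simp: partial_latin_square_def intro: finite_subset[of _ "{..<m} \<times> {..<n}"])
  define f where "f = (\<lambda>(i, j::nat, x::nat, y). (i, x, the (L (i, y))))"
  let ?T = "f ` ordered_intercalates L"
  let ?B = "(\<lambda>p. (snd p, the (L p))) ` dom L"
  let ?C = "(\<lambda>p. (fst p, the (L p))) ` dom L"
  \<comment> \<open>The symbol \<open>t\<close> occurs once in row \<open>i\<close>, which gives
    back \<open>y\<close>, and once in column \<open>x\<close>, which gives back
    \<open>j\<close>.\<close>
  have "inj_on f (ordered_intercalates L)"
    unfolding inj_on_def f_def ordered_intercalates_def
    by (clarsimp) (metis row col)
  then have "4 * card (intercalates L) = card ?T"
    by (simp add: card_image card_ordered_intercalates[OF fin])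
  also have "(card ?T)\<^sup>2 \<le> card (dom L) * card ?B * card ?C"
  proof (rule loomis_whitney_3)
    fix i x t assume "(i, x, t) \<in> ?T"
    then obtain j y where *: "(i, j, x, y) \<in> ordered_intercalates L" "t = the (L (i, y))"
      by (auto simp: f_def)
    then have "(i, x) \<in> dom L" "(i, y) \<in> dom L" "(j, x) \<in> dom L" "t = the (L (j, x))"
      by (auto simp: ordered_intercalates_def)
    with * show "(i, x) \<in> dom L \<and> (x, t) \<in> ?B \<and> (i, t) \<in> ?C"
      by (metis (no_types, lifting) fst_conv image_eqI snd_conv)
  qed (use fin in auto)
  also have "\<dots> \<le> card (dom L) * card (dom L) * card (dom L)"
    using fin by (intro mult_mono card_image_le) auto
  finally show ?thesis
    by (simp add: power3_eq_cube)
qed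

section \<open>Intercalates in the Cayley table of an elementary abelian 2-group\<close>

text \<open>Numbers below \<open>2 ^ k\<close> stand for the vectors of \<open>(Z/2)^k\<close>
  through their binary digits, with \<open>xor\<close> as addition.\<close>

definition xor_square :: "nat \<Rightarrow> (nat \<times> nat \<rightharpoonup> nat)" where
  "xor_square k = (\<lambda>(i, x). if i < 2 ^ k \<and> x < 2 ^ k then Some (xor i x) else None)"

lemma xor_less_power: "xor i x < 2 ^ k" if "i < 2 ^ k" "x < 2 ^ k" for i x :: nat
proof -
  have "take_bit k (xor i x) = xor i x"
    using that by (simp only: take_bit_xor take_bit_nat_eq_self)
  then show ?thesis
    by (metis take_bit_nat_less_exp)
qed

lemma xor_cancel_left: "xor i (xor i x) = x" for i x :: nat
  by (simp only: xor.assoc[symmetric] xor_self_eq xor.left_neutral)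

lemma xor_left_eq_iff: "xor i x = xor i y \<longleftrightarrow> x = y" for i x y :: nat
  by (metis xor_cancel_left)

lemma xor_right_eq_iff: "xor x i = xor y i \<longleftrightarrow> x = y" for i x y :: nat
  by (metis xor_left_eq_iff xor.commute)

lemma dom_xor_square: "dom (xor_square k) = {..<2 ^ k} \<times> {..<2 ^ k}"
  by (auto simp: xor_square_def split: if_splits)

lemma partial_latin_square_xor: "partial_latin_square (2 ^ k) (2 ^ k) (xor_square k)"
  unfolding partial_latin_square_def dom_xor_square
  by (auto simp: xor_square_def xor_left_eq_iff xor_right_eq_iff split: if_splits)

text \<open>A marked cell \<open>(i, x)\<close> and a second row \<open>j\<close> different from
  \<open>i\<close> extend to exactly one ordered intercalate, since equality of the symbols at
  \<open>(i, x)\<close> and \<open>(j, y)\<close> forces \<open>y = xor j (xor i x)\<close>.\<close>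

lemma card_intercalates_xor_square:
  "4 * real (card (intercalates (xor_square k))) = (2 ^ k)\<^sup>2 * (2 ^ k - 1)"
proof -
  let ?N = "{..<2 ^ k :: nat}"
  define f where "f = (\<lambda>((i, x), j::nat). (i, j, x, xor j (xor i x)))"
  let ?S = "SIGMA p:?N \<times> ?N. ?N - {fst p}"
  have U: "ordered_intercalates (xor_square k) = f ` ?S"
  proof (intro set_eqI iffI)
    fix z assume "z \<in> ordered_intercalates (xor_square k)"
    then obtain i j x y where z: "z = (i, j, x, y)" "i \<noteq> j"
      and d: "{(i, x), (i, y), (j, x), (j, y)} \<subseteq> dom (xor_square k)"
      and e: "xor_square k (i, x) = xor_square k (j, y)"
      unfolding ordered_intercalates_def by blast
    from d have lt: "i \<in> ?N" "j \<in> ?N" "x \<in> ?N" "y \<in> ?N"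
      by (auto simp: dom_xor_square)
    with e have "xor i x = xor j y"
      by (simp add: xor_square_def)
    then have "z = f ((i, x), j)"
      using z by (simp add: f_def xor_cancel_left)
    moreover have "((i, x), j) \<in> ?S"
      using z lt by auto
    ultimately show "z \<in> f ` ?S" by blast
  next
    fix z assume "z \<in> f ` ?S"
    then obtain p where p: "z = f p" "p \<in> ?S" by blast
    obtain i x j where "p = ((i, x), j)" by (metis surj_pair)
    with p have z: "z = (i, j, x, xor j (xor i x))" "i \<noteq> j"
      and lt: "i < 2 ^ k" "j < 2 ^ k" "x < 2 ^ k"
      by (auto simp: f_def)
    have "xor j (xor i x) < 2 ^ k"
      using lt by (intro xor_less_power)
    moreover have "x \<noteq> xor j (xor i x)"
    proof
      assume "x = xor j (xor i x)"
      then have "xor j x = xor i x"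
        using xor_cancel_left[of j "xor i x"] by simp
      with z(2) show False by (simp add: xor_right_eq_iff)
    qed
    \<comment> \<open>The second equality of symbols comes for free because \<open>i\<close> is its
      own inverse; this is where exponent two enters.\<close>
    moreover have "xor i (xor j (xor i x)) = xor j x"
      by (simp only: xor.left_commute[of i j] xor_cancel_left)
    moreover have "xor_square k (a, b) = Some (xor a b)" if "a < 2 ^ k" "b < 2 ^ k" for a b
      using that by (simp add: xor_square_def)
    ultimately show "z \<in> ordered_intercalates (xor_square k)"
      using z lt by (simp add: ordered_intercalates_def dom_xor_square xor_cancel_left)
  qed
  have "inj_on f ?S"
    by (auto simp: inj_on_def f_def)
  then have "4 * card (intercalates (xor_square k)) = card ?S"
    using card_ordered_intercalates[of "xor_square k"] U by (simp add: dom_xor_square card_image)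
  also have "\<dots> = (\<Sum>p\<in>?N \<times> ?N. card (?N - {fst p}))"
    by simp
  also have "\<dots> = (\<Sum>p\<in>?N \<times> ?N. 2 ^ k - 1)"
    by (intro sum.cong) auto
  also have "\<dots> = (2 ^ k)\<^sup>2 * (2 ^ k - 1)"
    by (simp add: power2_eq_square)
  finally have "real (4 * card (intercalates (xor_square k))) = real ((2 ^ k)\<^sup>2 * (2 ^ k - 1))"
    by presburger
  then show ?thesis
    by (simp add: of_nat_diff)
qed

section \<open>Existence of optimal squares, monotonicity and subadditivity of
  \<open>Phi\<close>\<close>

lemma Phi_le:
  fixes L :: "nat \<times> nat \<rightharpoonup> nat"
  assumes "partial_latin_square m n L" "N \<le> real (card (intercalates L))"
  shows "Phi N \<le> card (dom L)"
  unfolding Phi_def using assms by (intro Least_le) blast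

lemma powr_third_cubed: "(x powr (1/3)) ^ 3 = x" if "0 \<le> x" for x :: real
  using that by (simp add: powr_powr flip: powr_numeral)

lemma powr_third_squared: "(x powr (1/3))\<^sup>2 = x powr (2/3)" for x :: real
  by (simp add: power2_eq_square flip: powr_add)

lemma squared_powr_third: "(x\<^sup>2) powr (1/3) = x powr (2/3)" if "0 \<le> x" for x :: real
  using that by (simp add: powr_powr flip: powr_numeral)

text \<open>Rounding a side length up to a power of two costs less than a factor two, hence less
  than a factor four in cells: the source of the 4 in (3).\<close>

lemma ex_power_two_ivl:
  fixes q :: real
  assumes "1 \<le> q"
  obtains k :: nat where "q \<le> 2 ^ k" "2 ^ k < 2 * q"
proof -
  obtain k0 :: nat where "q < 2 ^ k0"
    using real_arch_pow[of 2 q] by auto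
  then have k0: "q \<le> 2 ^ k0" by simp
  define k where "k = (LEAST k. q \<le> (2::real) ^ k)"
  have k: "q \<le> 2 ^ k" unfolding k_def using k0 by (rule LeastI)
  have "2 ^ k < 2 * q"
  proof (cases k)
    case 0
    then show ?thesis using assms by simp
  next
    case (Suc l)
    then have "\<not> q \<le> 2 ^ l"
      using not_less_Least[of l "\<lambda>k. q \<le> 2 ^ k"] by (simp add: k_def)
    then show ?thesis by (simp add: Suc)
  qed
  with k show ?thesis by (rule that)
qed

lemma Phi_square: "Phi ((2 ^ k)\<^sup>2 * (2 ^ k - 1) / 4) \<le> (2 ^ k)\<^sup>2"
  using Phi_le[OF partial_latin_square_xor[of k], of "(2 ^ k)\<^sup>2 * (2 ^ k - 1) / 4"]
    card_intercalates_xor_square[of k]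
  by (simp add: dom_xor_square power2_eq_square)

lemma ex_xor_square_crude:
  fixes x :: real
  assumes "0 \<le> x"
  obtains k where "x \<le> (2 ^ k)\<^sup>2 * (2 ^ k - 1) / 4" "(2 ^ k)\<^sup>2 \<le> 16 + 16 * x powr (2/3)"
proof -
  \<comment> \<open>The 2 gives \<open>n - 1 \<ge> n / 2\<close> for \<open>n = 2 ^ k\<close>, so
    there are at least \<open>n ^ 3 / 8\<close> ordered intercalates over 4 after doubling; the
    factor 2 on the cube root makes \<open>n ^ 3 \<ge> 8 * x\<close> absorb this loss.\<close>
  define q where "q = max 2 (2 * x powr (1/3))"
  have "1 \<le> q" by (simp add: q_def)
  then obtain k :: nat where k: "q \<le> 2 ^ k" "2 ^ k < 2 * q"
    by (rule ex_power_two_ivl)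
  let ?n = "2 ^ k :: real"
  have n2: "2 \<le> ?n" and "2 * x powr (1/3) \<le> ?n"
    using k(1) by (auto simp: q_def)
  then have "(2 * x powr (1/3)) ^ 3 \<le> ?n ^ 3"
    by (intro power_mono) auto
  moreover have "(2 * x powr (1/3)) ^ 3 = 8 * x"
    using assms by (simp add: power_mult_distrib powr_third_cubed)
  ultimately have "8 * x \<le> ?n ^ 3" by simp
  moreover have "?n ^ 3 \<le> ?n\<^sup>2 * (?n - 1) * 2"
    using mult_left_mono[OF n2, of "?n\<^sup>2"] by (simp add: power3_eq_cube power2_eq_square algebra_simps)
  ultimately have 1: "x \<le> ?n\<^sup>2 * (?n - 1) / 4" by simp
  have "?n\<^sup>2 \<le> (2 * q)\<^sup>2"
    using k(2) by (intro power_mono) auto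
  also have "\<dots> \<le> 16 + 16 * (x powr (1/3))\<^sup>2"
    by (auto simp: q_def max_def power_mult_distrib)
  also have "(x powr (1/3))\<^sup>2 = x powr (2/3)"
    by (rule powr_third_squared)
  finally show ?thesis using 1 that by blast
qed

text \<open>A large enough xor square shows that the set under \<open>LEAST\<close> is nonempty, so
  the minimum is attained.\<close>

lemma Phi_witness:
  obtains m n and L :: "nat \<times> nat \<rightharpoonup> nat"
  where "partial_latin_square m n L" "N \<le> real (card (intercalates L))" "card (dom L) = Phi N"
proof -
  \<comment> \<open>\<open>Phi\<close> may be evaluated at a negative real, while the crude bound
    asks for a nonnegative one.\<close>
  obtain k where k: "max 0 N \<le> (2 ^ k)\<^sup>2 * (2 ^ k - 1) / 4"
    using ex_xor_square_crude[of "max 0 N"] by auto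
  have "\<exists>c m n (L :: nat \<times> nat \<rightharpoonup> nat).
     partial_latin_square m n L \<and> real (card (intercalates L)) \<ge> N \<and> card (dom L) = c"
    using k card_intercalates_xor_square[of k] partial_latin_square_xor[of k]
    by (intro exI[of _ "card (dom (xor_square k))"] exI[of _ "2 ^ k"] exI[of _ "xor_square k"]) auto
  from LeastI_ex[OF this] show ?thesis
    using that unfolding Phi_def by blast
qed

lemma Phi_mono: "N \<le> N' \<Longrightarrow> Phi N \<le> Phi N'"
  by (rule Phi_witness[of N']) (metis Phi_le order_trans)

text \<open>Place optimal squares for \<open>a\<close> and \<open>b\<close> as diagonal blocks. The
  blocks share no row and no column, so they may use the same symbols.\<close>

lemma Phi_add_le: "Phi (a + b) \<le> Phi a + Phi b"
proof -
  obtain m n and A :: "nat \<times> nat \<rightharpoonup> nat" where A: "partial_latin_square m n A"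
    "a \<le> real (card (intercalates A))" "card (dom A) = Phi a"
    by (rule Phi_witness)
  obtain m' n' and B :: "nat \<times> nat \<rightharpoonup> nat" where B: "partial_latin_square m' n' B"
    "b \<le> real (card (intercalates B))" "card (dom B) = Phi b"
    by (rule Phi_witness)
  have domA: "i < m \<and> x < n" if "A (i, x) = Some s" for i x s
    using A(1) that by (force simp: partial_latin_square_def)
  have domB: "i < m' \<and> x < n'" if "B (i, x) = Some s" for i x s
    using B(1) that by (force simp: partial_latin_square_def)
  have fin: "finite (dom A)" "finite (dom B)"
    using A(1) B(1) unfolding partial_latin_square_def by (meson finite_SigmaI finite_lessThan finite_subset)+
  have rowA: "x = y" if "A (i, x) = Some s" "A (i, y) = Some s" for i x y s
    using A(1) that unfolding partial_latin_square_def by blast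
  have colA: "i = j" if "A (i, x) = Some s" "A (j, x) = Some s" for i j x s
    using A(1) that unfolding partial_latin_square_def by blast
  have rowB: "x = y" if "B (i, x) = Some s" "B (i, y) = Some s" for i x y s
    using B(1) that unfolding partial_latin_square_def by blast
  have colB: "i = j" if "B (i, x) = Some s" "B (j, x) = Some s" for i j x s
    using B(1) that unfolding partial_latin_square_def by blast
  define C where "C = (\<lambda>(i, x). if i < m \<and> x < n then A (i, x)
    else if m \<le> i \<and> n \<le> x then B (i - m, x - n) else None)"
  let ?s = "\<lambda>(i, x). (i + m, x + n)"
  let ?t = "\<lambda>(i, j, x, y). (i + m, j + m, x + n, y + n)"
  have CA: "C (i, x) = A (i, x)" if "(i, x) \<in> dom A" for i x
    using that by (auto simp: C_def dest: domA)
  have CB: "C (i + m, x + n) = B (i, x)" for i x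
    by (simp add: C_def)
  have C: "partial_latin_square (m + m') (n + n') C"
    unfolding partial_latin_square_def
  proof (intro conjI allI impI subsetI)
    fix p assume "p \<in> dom C"
    then show "p \<in> {..<m + m'} \<times> {..<n + n'}"
      by (cases p) (auto simp: C_def split: if_splits dest!: domB)
  next
    fix i x y s assume "C (i, x) = Some s \<and> C (i, y) = Some s"
    then show "x = y"
      by (auto simp: C_def split: if_splits dest: rowA) (metis rowB eq_diff_iff)
  next
    fix i j x s assume "C (i, x) = Some s \<and> C (j, x) = Some s"
    then show "i = j"
      by (auto simp: C_def split: if_splits dest: colA) (metis colB eq_diff_iff)
  qed
  have dC: "dom C \<subseteq> dom A \<union> ?s ` dom B"
  proof
    fix p assume "p \<in> dom C"
    then show "p \<in> dom A \<union> ?s ` dom B"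
      by (cases p) (force simp: C_def image_iff split: if_splits intro: bexI[of _ "(fst p - m, snd p - n)"])
  qed
  then have finC: "finite (dom C)"
    using fin by (auto intro: finite_subset)
  have "card (dom C) \<le> card (dom A \<union> ?s ` dom B)"
    using dC fin by (intro card_mono) auto
  also have "\<dots> \<le> card (dom A) + card (dom B)"
    by (rule order_trans[OF card_Un_le]) (simp add: card_image_le fin)
  finally have card_dom: "card (dom C) \<le> Phi a + Phi b"
    by (simp add: A B)
  have "intercalates A \<subseteq> intercalates C"
    by (auto simp: intercalates_def CA domIff)
  moreover have "?t ` intercalates B \<subseteq> intercalates C"
    by (auto simp: intercalates_def CB domIff)
  ultimately have "card (intercalates A \<union> ?t ` intercalates B) \<le> card (intercalates C)"
    by (intro card_mono finite_intercalates finC) auto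
  moreover have "card (intercalates A \<union> ?t ` intercalates B) = card (intercalates A) + card (intercalates B)"
  proof (subst card_Un_disjoint)
    show "intercalates A \<inter> ?t ` intercalates B = {}"
      by (auto simp: intercalates_def dest!: domA)
    have "inj_on ?t (intercalates B)"
      by (auto simp: inj_on_def)
    then show "card (intercalates A) + card (?t ` intercalates B) = card (intercalates A) + card (intercalates B)"
      by (simp add: card_image)
  qed (use fin finite_intercalates in auto)
  ultimately have "a + b \<le> real (card (intercalates C))"
    using A(2) B(2) by linarith
  from Phi_le[OF C this] card_dom show ?thesis
    by linarith
qed

section \<open>Explicit lower, upper and perturbation bounds for \<open>Phi\<close>\<close>

lemma Phi_ge: "(4 * N) powr (2/3) \<le> real (Phi N)" if "0 \<le> N"
proof -
  obtain m n and L :: "nat \<times> nat \<rightharpoonup> nat" where L: "partial_latin_square m n L"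
    "N \<le> real (card (intercalates L))" "card (dom L) = Phi N"
    by (rule Phi_witness)
  have "(4 * N)\<^sup>2 \<le> (4 * real (card (intercalates L)))\<^sup>2"
    using that L(2) by (intro power_mono) auto
  also have "\<dots> = real ((4 * card (intercalates L))\<^sup>2)"
    by simp
  also have "\<dots> \<le> real (Phi N ^ 3)"
    using intercalates_bound[OF L(1)] L(3) by (intro of_nat_mono) simp
  finally have "((4 * N)\<^sup>2) powr (1/3) \<le> (real (Phi N) ^ 3) powr (1/3)"
    by (intro powr_mono2) auto
  moreover have "((4 * N)\<^sup>2) powr (1/3) = (4 * N) powr (2/3)"
    using that by (intro squared_powr_third) simp
  moreover have "(real (Phi N) ^ 3) powr (1/3) = real (Phi N)"
    by (simp add: powr_powr flip: powr_numeral)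
  ultimately show ?thesis by simp
qed

text \<open>The constants are wasteful but the exponent is right, which suffices wherever
  \<open>x\<close> is of lower order than the main argument.\<close>

lemma Phi_crude:
  assumes "0 \<le> x"
  shows "real (Phi x) \<le> 16 + 16 * x powr (2/3)"
proof -
  obtain k where k: "x \<le> (2 ^ k)\<^sup>2 * (2 ^ k - 1) / 4" "(2 ^ k)\<^sup>2 \<le> 16 + 16 * x powr (2/3)"
    using ex_xor_square_crude[OF assms] .
  have "Phi x \<le> (2 ^ k)\<^sup>2"
    using Phi_mono[OF k(1)] Phi_square[of k] by linarith
  then have "real (Phi x) \<le> real ((2 ^ k)\<^sup>2)"
    by (rule of_nat_mono)
  then show ?thesis using k(2) by simp
qed

text \<open>With \<open>n = 2 ^ k\<close>, the Cayley table falls \<open>n^2 / 4\<close> short of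
  \<open>n^3 / 4\<close> intercalates. By subadditivity a second square supplies them for
  \<open>O(n powr (4/3))\<close> further cells.\<close>

lemma Phi_cube:
  "real (Phi ((2 ^ k) ^ 3 / 4)) \<le> (2 ^ k)\<^sup>2 + 16 + 16 * ((2 ^ k)\<^sup>2 / 4) powr (2/3)"
proof -
  have "((2 ^ k) ^ 3 / 4 :: real) = (2 ^ k)\<^sup>2 * (2 ^ k - 1) / 4 + (2 ^ k)\<^sup>2 / 4"
    by (simp add: power3_eq_cube power2_eq_square field_simps)
  then have "Phi ((2 ^ k) ^ 3 / 4) \<le> Phi ((2 ^ k)\<^sup>2 * (2 ^ k - 1) / 4) + Phi ((2 ^ k)\<^sup>2 / 4)"
    by (simp only: Phi_add_le)
  also have "\<dots> \<le> (2 ^ k)\<^sup>2 + Phi ((2 ^ k)\<^sup>2 / 4)"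
    by (intro add_right_mono Phi_square)
  finally have "Phi ((2 ^ k) ^ 3 / 4) \<le> (2 ^ k)\<^sup>2 + Phi ((2 ^ k)\<^sup>2 / 4)" .
  then have "real (Phi ((2 ^ k) ^ 3 / 4)) \<le> real ((2 ^ k)\<^sup>2 + Phi ((2 ^ k)\<^sup>2 / 4))"
    by (rule of_nat_mono)
  then show ?thesis
    using Phi_crude[of "(2 ^ k)\<^sup>2 / 4"] by simp
qed

text \<open>The cost of the second square in \<open>Phi_cube\<close> relative to
  \<open>(4 * N) powr (2/3)\<close>, with \<open>(2 ^ k)\<^sup>2 / 4\<close> replaced by its upper
  bound \<open>(4 * N) powr (2/3)\<close>.\<close>

definition Phi_err :: "nat \<Rightarrow> real" where
  "Phi_err N = (16 + 16 * ((4 * real N) powr (2/3)) powr (2/3)) / (4 * real N) powr (2/3)"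

lemma Phi_err_smallo: "Phi_err \<in> o(\<lambda>_. 1)"
  unfolding Phi_err_def by real_asymp

text \<open>Common source of (2), where \<open>2 ^ k\<close> equals the cube root of
  \<open>4 * N\<close>, and (3), where it is rounded up. The term \<open>(2 ^ k)\<^sup>2\<close>
  stays exact, and the factor 2 is spent in the correction.\<close>

lemma Phi_le_power_two:
  assumes "0 < N" "(4 * real N) powr (1/3) \<le> 2 ^ k" "2 ^ k \<le> 2 * (4 * real N) powr (1/3)"
  shows "real (Phi (real N)) \<le> (2 ^ k)\<^sup>2 + Phi_err N * (4 * real N) powr (2/3)"
proof -
  let ?q = "(4 * real N) powr (1/3)"
  have q2: "?q\<^sup>2 = (4 * real N) powr (2/3)"
    by (rule powr_third_squared)
  have "?q ^ 3 = 4 * real N"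
    by (simp add: powr_third_cubed)
  moreover have "?q ^ 3 \<le> (2 ^ k) ^ 3"
    using assms by (intro power_mono) auto
  ultimately have "real N \<le> (2 ^ k) ^ 3 / 4" by simp
  then have "real (Phi (real N)) \<le> real (Phi ((2 ^ k) ^ 3 / 4))"
    by (intro of_nat_mono Phi_mono)
  also have "\<dots> \<le> (2 ^ k)\<^sup>2 + 16 + 16 * ((2 ^ k)\<^sup>2 / 4) powr (2/3)"
    by (rule Phi_cube)
  also have "(2 ^ k)\<^sup>2 \<le> (2 * ?q)\<^sup>2"
    using assms by (intro power_mono) auto
  then have "((2 ^ k)\<^sup>2 / 4) powr (2/3) \<le> ((4 * real N) powr (2/3)) powr (2/3)"
    by (intro powr_mono2) (auto simp: power_mult_distrib q2)
  finally show ?thesis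
    using assms(1) by (simp add: Phi_err_def)
qed

text \<open>Subadditivity and monotonicity bound the change by \<open>Phi \<bar>d\<bar>\<close>; for
  negative \<open>d\<close> they are applied to \<open>N = (N + d) + (- d)\<close>.\<close>

lemma Phi_perturb:
  "\<bar>real (Phi (N + d)) - real (Phi N)\<bar> \<le> 16 + 16 * \<bar>d\<bar> powr (2/3)"
proof -
  have "\<bar>real (Phi (N + d)) - real (Phi N)\<bar> \<le> real (Phi \<bar>d\<bar>)"
  proof (cases "0 \<le> d")
    case True
    then show ?thesis
      using Phi_add_le[of N d] Phi_mono[of N "N + d"] by simp
  next
    case False
    then show ?thesis
      using Phi_add_le[of "N + d" "- d"] Phi_mono[of "N + d" N] by simp
  qed
  then show ?thesis
    using Phi_crude[of "\<bar>d\<bar>"] by simp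
qed

section \<open>From the explicit bounds to the four asymptotic statements\<close>

theorem theorem2p3:
  shows "(\<exists>e :: nat \<Rightarrow> real. e \<in> o(\<lambda>_. 1) \<and>
            (\<forall>N :: nat. real (Phi (real N)) \<ge> (1 + e N) * (4 * real N) powr (2/3))) \<and>
         (\<exists>e :: nat \<Rightarrow> real. e \<in> o(\<lambda>_. 1) \<and>
            (\<forall>N :: nat. (\<exists>k :: nat. (4 * real N) powr (1/3) = 2 ^ k) \<longrightarrow>
               real (Phi (real N)) = (1 + e N) * (4 * real N) powr (2/3))) \<and>
         (\<exists>e :: nat \<Rightarrow> real. e \<in> o(\<lambda>_. 1) \<and>
            (\<forall>N :: nat. real (Phi (real N)) \<le> (4 + e N) * (4 * real N) powr (2/3))) \<and>
         (\<forall>\<epsilon> :: nat \<Rightarrow> real. \<epsilon> \<in> o(\<lambda>_. 1) \<longrightarrow>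
            (\<lambda>N :: nat. real (Phi (real N + \<epsilon> N * real N)) - real (Phi (real N)))
              \<in> o(\<lambda>N. real N powr (2/3)))"
proof (intro conjI)
  let ?Q = "\<lambda>N::nat. (4 * real N) powr (2/3)"
  show "\<exists>e :: nat \<Rightarrow> real. e \<in> o(\<lambda>_. 1) \<and> (\<forall>N :: nat. real (Phi (real N)) \<ge> (1 + e N) * ?Q N)"
    by (rule exI[of _ "\<lambda>_. 0"]) (simp add: Phi_ge)
next
  let ?Q = "\<lambda>N::nat. (4 * real N) powr (2/3)"
  let ?P = "\<lambda>N::nat. \<exists>k :: nat. (4 * real N) powr (1/3) = 2 ^ k"
  \<comment> \<open>The exact relative error where the equation is claimed and 0 elsewhere, so that
    only its decay remains to be shown.\<close>
  define e where "e N = (if ?P N then real (Phi (real N)) / ?Q N - 1 else 0)" for N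
  have P: "0 < N \<and> real (Phi (real N)) \<le> ?Q N + Phi_err N * ?Q N" if N: "?P N" for N
  proof -
    obtain k :: nat where k: "(4 * real N) powr (1/3) = 2 ^ k" using N by blast
    \<comment> \<open>At \<open>N = 0\<close> the left side is \<open>0 powr (1/3) = 0\<close>,
      which is no power of two.\<close>
    then have "0 < N" by (cases N) auto
    moreover have "(2 ^ k :: real)\<^sup>2 = ?Q N"
      by (simp only: powr_third_squared flip: k)
    ultimately show ?thesis
      using Phi_le_power_two[of N k] k by simp
  qed
  have "\<bar>e N\<bar> \<le> Phi_err N" for N
  proof (cases "?P N")
    case True
    with P have "0 < ?Q N" "real (Phi (real N)) \<le> (1 + Phi_err N) * ?Q N"
      by (auto simp: algebra_simps)
    then show ?thesis
      using True Phi_ge[of "real N"] by (simp add: e_def divide_simps algebra_simps)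
  qed (simp add: e_def Phi_err_def)
  then have "norm (e N) \<le> 1 * norm (Phi_err N)" for N
    by (simp add: order_trans[OF _ abs_ge_self])
  then have "e \<in> O(Phi_err)"
    by (intro bigoI[of _ 1] always_eventually allI)
  then have "e \<in> o(\<lambda>_. 1)"
    using Phi_err_smallo by (rule landau_o.big_small_trans)
  moreover have "real (Phi (real N)) = (1 + e N) * ?Q N" if "?P N" for N
    using that P[OF that] by (simp add: e_def)
  ultimately show "\<exists>e :: nat \<Rightarrow> real. e \<in> o(\<lambda>_. 1) \<and>
      (\<forall>N. ?P N \<longrightarrow> real (Phi (real N)) = (1 + e N) * ?Q N)"
    by blast
next
  let ?Q = "\<lambda>N::nat. (4 * real N) powr (2/3)"
  have "real (Phi (real N)) \<le> (4 + Phi_err N) * ?Q N" for N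
  proof (cases "N = 0")
    case True
    \<comment> \<open>At \<open>N = 0\<close> the right side vanishes, so \<open>Phi 0 = 0\<close>
      is needed; the empty square provides it.\<close>
    have "partial_latin_square 0 0 (Map.empty :: nat \<times> nat \<rightharpoonup> nat)"
      by (simp add: partial_latin_square_def)
    from Phi_le[OF this, of 0] True show ?thesis by simp
  next
    case False
    let ?q = "(4 * real N) powr (1/3)"
    have "1 \<le> ?q" using False by (intro ge_one_powr_ge_zero) auto
    then obtain k :: nat where k: "?q \<le> 2 ^ k" "2 ^ k < 2 * ?q"
      using ex_power_two_ivl by blast
    have "(2 ^ k :: real)\<^sup>2 \<le> (2 * ?q)\<^sup>2"
      using k by (intro power_mono) auto
    also have "\<dots> = 4 * ?Q N"
      by (simp add: power_mult_distrib powr_third_squared)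
    finally show ?thesis
      using Phi_le_power_two[of N k] k False by (simp add: algebra_simps)
  qed
  then show "\<exists>e :: nat \<Rightarrow> real. e \<in> o(\<lambda>_. 1) \<and> (\<forall>N. real (Phi (real N)) \<le> (4 + e N) * ?Q N)"
    using Phi_err_smallo by blast
next
  show "\<forall>\<epsilon> :: nat \<Rightarrow> real. \<epsilon> \<in> o(\<lambda>_. 1) \<longrightarrow>
      (\<lambda>N. real (Phi (real N + \<epsilon> N * real N)) - real (Phi (real N))) \<in> o(\<lambda>N. real N powr (2/3))"
  proof (intro allI impI)
    fix \<epsilon> :: "nat \<Rightarrow> real" assume "\<epsilon> \<in> o(\<lambda>_. 1)"
    then have "\<epsilon> \<longlonglongrightarrow> 0"
      by (auto dest: smalloD_tendsto)
    then have "(\<lambda>N. \<bar>\<epsilon> N\<bar>) \<longlonglongrightarrow> 0"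
      by (rule tendsto_rabs_zero)
    then have "(\<lambda>N. \<bar>\<epsilon> N\<bar> powr (2/3)) \<longlonglongrightarrow> 0"
      by (intro tendsto_zero_powrI[where b = "2/3"]) auto
    then have "(\<lambda>N. \<bar>\<epsilon> N\<bar> powr (2/3)) \<in> o(\<lambda>_. 1)"
      by (intro smalloI_tendsto) auto
    then have 1: "(\<lambda>N. \<bar>\<epsilon> N\<bar> powr (2/3) * real N powr (2/3)) \<in> o(\<lambda>N. real N powr (2/3))"
      using landau_o.small_big_mult[OF _ landau_o.big_refl] by fastforce
    have 2: "(\<lambda>_. 16) \<in> o(\<lambda>N::nat. real N powr (2/3))"
      by real_asymp
    \<comment> \<open>This is the bound of \<open>Phi_perturb\<close> at
      \<open>d = \<epsilon> N * N\<close>, factored so that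
      \<open>\<bar>\<epsilon> N\<bar> powr (2/3)\<close> tends to 0 in front of
      \<open>N powr (2/3)\<close>.\<close>
    let ?h = "\<lambda>N::nat. 16 + 16 * (\<bar>\<epsilon> N\<bar> powr (2/3) * real N powr (2/3))"
    have "(\<lambda>N. real (Phi (real N + \<epsilon> N * real N)) - real (Phi (real N))) \<in> O(?h)"
    proof (intro bigoI[of _ 1] always_eventually allI)
      fix N :: nat
      have "\<bar>\<epsilon> N * real N\<bar> powr (2/3) = \<bar>\<epsilon> N\<bar> powr (2/3) * real N powr (2/3)"
        by (simp add: abs_mult powr_mult)
      then show "norm (real (Phi (real N + \<epsilon> N * real N)) - real (Phi (real N))) \<le> 1 * norm (?h N)"
        using Phi_perturb[of "real N" "\<epsilon> N * real N"] by simp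
    qed
    moreover have "?h \<in> o(\<lambda>N. real N powr (2/3))"
      using 1 2 by (intro sum_in_smallo) auto
    ultimately show "(\<lambda>N. real (Phi (real N + \<epsilon> N * real N)) - real (Phi (real N)))
        \<in> o(\<lambda>N. real N powr (2/3))"
      by (rule landau_o.big_small_trans)
  qed
qed

end
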